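(* Consider the SUM cost on an $s$–$t$ graph $G$ whose $s$–$t$ paths are pairwise disjoint, with $n\ge1$ agents, $k\ge1$ interceptors and $\alpha>0$. Then $$\min_{\sigma\in(\Delta(P_{st}))^n}F_n(\sigma,\alpha)=\min_{\sigma\in\operatorname{conv}(\mathcal{U}_n)}F_n(\sigma,\alpha).$$
   Context: Graph: $G=(V,E,s,t)$ is a finite directed acyclic multigraph ($E$ is a multiset) with source $s$ and sink $t\neq s$, such that $E\ne\emptyset$ and every edge lies on some directed $s$–$t$ path. $P_{st}=\{p_1,\dots,p_m\}$ is the set of directed $s$–$t$ paths, treated as sets of edges, pairwise disjoint, with $|p_1|\le\dots\le|p_m|$ ($|p|$ is the number of edges). $P_i=\{p_1,\dots,p_i\}$. Strategies: each of the $n$ agents picks a path, giving $a=(a_1,\dots,a_n)\in(P_{st})^n$, with $\bigcup a=\bigcup_i a_i\subseteq E$; the $k$ interceptors pick $d=(d_1,\dots,d_k)\in E^k$. $\Delta X$ is the set of probability distributions on $X$. An element $\sigma=(\sigma_1,\dots,\sigma_n)\in(\Delta(P_{st}))^n$ is identified with the product distribution on $(P_{st})^n$. SUM cost: $C(a,d,\alpha)=\left|\bigcup a\right|+\alpha\sum_{j\le k}\mathbf 1\{d_j\in\bigcup a\}$, and $F_n(\sigma,\alpha)=\max_{d\in E^k}\mathbb{E}_{a\sim\sigma}[C(a,d,\alpha)]$. Uniform strategies (for disjoint paths): $\mathcal{U}_n=\{U_{P_i}^n:1\le i\le m\}$, where $U_P$ is the uniform distribution on $P$ and $U_P^n=(U_P,\dots,U_P)\in(\Delta(P_{st}))^n$.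 The convex hull $\operatorname{conv}(\mathcal{U}_n)$ is taken in $\mathbb{R}^{mn}$, viewing $\sigma=(\sigma_1,\dots,\sigma_n)$ as the vector of its marginals' probabilities $(\sigma_j(p_i))_{i,j}$. *)

theory Defs
  imports
    "HOL-Probability.Probability"
    "HOL-Library.Function_Algebras"
    "Graph_Theory.Arc_Walk"
begin

text \<open>
  Pointwise real scaling makes function spaces real vector spaces, so that the library's
  convex hull is available for matrices of a size fixed only by the graph: the space of real
  \<open>n \<times> m\<close> matrices is the subspace of \<^typ>\<open>nat \<Rightarrow> nat \<Rightarrow> real\<close> of functions vanishing outside
  \<open>{..<n} \<times> {..<m}\<close>.
\<close>

instantiation "fun" :: (type, real_vector) real_vector
begin

definition "r *\<^sub>R f = (\<lambda>x. r *\<^sub>R f x)"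

instance
  by standard (auto simp: scaleR_fun_def plus_fun_def fun_eq_iff scaleR_add_right scaleR_add_left)

end

text \<open>
  Directed \<open>s\<close>-\<open>t\<close> paths as edge sets. The library's pre-digraphs admit parallel arcs. In an
  acyclic digraph every walk has distinct vertices.
\<close>

definition (in pre_digraph) st_paths :: "'a \<Rightarrow> 'a \<Rightarrow> 'b set set" where
  "st_paths s t = set ` {p. apath s p t}"

locale st_graph = fin_digraph G for G :: "('v, 'e) pre_digraph" +
  fixes s t :: 'v
  assumes acyclic: "\<nexists>c. cycle c"
    and source_in_verts: "s \<in> verts G"
    and sink_in_verts: "t \<in> verts G"
    and source_neq_sink: "s \<noteq> t"
    and arcs_nonempty: "arcs G \<noteq> {}"
    and arc_on_st_path: "\<And>e. e \<in> arcs G \<Longrightarrow> \<exists>p \<in> st_paths s t. e \<in> p"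

definition dists :: "'a set \<Rightarrow> 'a pmf set" where
  "dists X = {\<mu>. set_pmf \<mu> \<subseteq> X}"

text \<open>
  Agents and interceptors are numbered from \<open>0\<close>; \<open>n\<close>-tuples over \<open>X\<close> are the elements of
  \<open>{..<n} \<rightarrow>\<^sub>E X\<close>.
\<close>

definition strategies :: "nat \<Rightarrow> 'e set set \<Rightarrow> (nat \<Rightarrow> 'e set pmf) set" where
  "strategies n P = {..<n} \<rightarrow>\<^sub>E dists P"

definition sum_cost :: "nat \<Rightarrow> nat \<Rightarrow> (nat \<Rightarrow> 'e set) \<Rightarrow> (nat \<Rightarrow> 'e) \<Rightarrow> real \<Rightarrow> real" where
  "sum_cost n k a d \<alpha> =
     real (card (\<Union>i<n. a i)) + \<alpha> * (\<Sum>j<k. of_bool (d j \<in> (\<Union>i<n. a i)))"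

text \<open>The product distribution takes the default value \<^const>\<open>undefined\<close> outside \<open>{..<n}\<close>,
  so it is supported on \<open>{..<n} \<rightarrow>\<^sub>E P\<close>.\<close>

definition worst_cost :: "'e set \<Rightarrow> nat \<Rightarrow> nat \<Rightarrow> (nat \<Rightarrow> 'e set pmf) \<Rightarrow> real \<Rightarrow> real" where
  "worst_cost E n k \<sigma> \<alpha> =
     Max ((\<lambda>d. measure_pmf.expectation (Pi_pmf {..<n} undefined \<sigma>) (\<lambda>a. sum_cost n k a d \<alpha>))
          ` ({..<k} \<rightarrow>\<^sub>E E))"

text \<open>Below, \<open>ps\<close> is the list \<open>[p\<^sub>1, \<dots>, p\<^sub>m]\<close> of all paths by nondecreasing length.\<close>

definition uniform_strategies :: "nat \<Rightarrow> 'e set list \<Rightarrow> (nat \<Rightarrow> 'e set pmf) set" where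
  "uniform_strategies n ps =
     (\<lambda>i. \<lambda>j\<in>{..<n}. pmf_of_set (set (take i ps))) ` {1..length ps}"

definition marginals :: "nat \<Rightarrow> 'e set list \<Rightarrow> (nat \<Rightarrow> 'e set pmf) \<Rightarrow> nat \<Rightarrow> nat \<Rightarrow> real" where
  "marginals n ps \<sigma> = (\<lambda>j i. if j < n \<and> i < length ps then pmf (\<sigma> j) (ps ! i) else 0)"

definition conv_strategies ::
    "nat \<Rightarrow> 'e set list \<Rightarrow> (nat \<Rightarrow> 'e set pmf) set \<Rightarrow> (nat \<Rightarrow> 'e set pmf) set" where
  "conv_strategies n ps S =
     {\<sigma> \<in> strategies n (set ps). marginals n ps \<sigma> \<in> convex hull (marginals n ps ` S)}"

end

theory Submission
  imports Defs
begin

text \<open>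
  Let \<open>q\<^sub>i\<close> be the probability that some agent uses \<open>p\<^sub>i\<close>. As the paths are disjoint, the worst
  expected cost is \<open>\<Sum>i. \<bar>p\<^sub>i\<bar> q\<^sub>i + \<alpha> k max\<^sub>i q\<^sub>i\<close>. By the AM-GM inequality, giving every agent the
  average of all marginals decreases each \<open>q\<^sub>i\<close>; they become \<open>q\<^sub>i = 1 - (1 - x\<^sub>i)^n\<close>. Sorting \<open>x\<close>
  in nonincreasing order keeps the maximum and, by rearrangement, does not increase the sum.
  The nonincreasing symmetric strategies form the convex hull of the uniform ones, and on this
  compact set the cost, where the maximum is attained at \<open>p\<^sub>1\<close>, is continuous.
\<close>

section \<open>Hitting probabilities and the expected cost\<close>

definition hit_prob :: "nat \<Rightarrow> (nat \<Rightarrow> 'a pmf) \<Rightarrow> 'a \<Rightarrow> real" where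
  "hit_prob n \<sigma> p = 1 - (\<Prod>j<n. 1 - pmf (\<sigma> j) p)"

lemma hit_prob_nonneg: "hit_prob n \<sigma> p \<ge> 0"
  unfolding hit_prob_def
  by (simp add: prod_le_1 pmf_le_1)

text \<open>By independence: that no agent picks \<open>p\<close> is a product event, whose
  probability is the product of the avoidance probabilities.\<close>

lemma prob_exists_component_eq:
  "measure_pmf.prob (Pi_pmf {..<n} dflt \<sigma>) {a. \<exists>i<n. a i = p} = hit_prob n \<sigma> p"
proof -
  have eq: "{a. \<exists>i<n. a i = p} = - Pi {..<n} (\<lambda>_. - {p})"
    by (auto simp: Pi_def)
  have "measure_pmf.prob (\<sigma> j) (- {p}) = 1 - pmf (\<sigma> j) p" for j
    using measure_pmf.prob_compl[of "{p}" "\<sigma> j"]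
    by (simp add: Compl_eq_Diff_UNIV measure_pmf_single)
  hence "measure_pmf.prob (Pi_pmf {..<n} dflt \<sigma>) (Pi {..<n} (\<lambda>_. - {p}))
      = (\<Prod>j<n. 1 - pmf (\<sigma> j) p)"
    by (simp add: measure_Pi_pmf_Pi)
  thus ?thesis
    using measure_pmf.prob_compl[of "Pi {..<n} (\<lambda>_. - {p})" "Pi_pmf {..<n} dflt \<sigma>"]
    by (simp add: eq hit_prob_def Compl_eq_Diff_UNIV)
qed

text \<open>Disjointness makes the size of the union and the indicator of each attacked arc additive
  over the used paths. The cost thus becomes linear in the events "some agent uses
  \<open>p\<close>", and expectations can be taken path by path.\<close>

lemma sum_cost_eq_sum_paths:
  assumes "finite P" "\<And>p. p \<in> P \<Longrightarrow> finite p" "pairwise disjnt P" "a ` {..<n} \<subseteq> P"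
  shows "sum_cost n k a d \<alpha> =
    (\<Sum>p\<in>P. (real (card p) + \<alpha> * (\<Sum>j<k. of_bool (d j \<in> p))) * of_bool (\<exists>i<n. a i = p))"
proof -
  \<comment> \<open>Taken as a set, so that a path shared by several agents counts once.\<close>
  define Q where "Q = {p\<in>P. \<exists>i<n. a i = p}"
  have U: "(\<Union>i<n. a i) = \<Union>Q"
    using assms(4) by (auto simp: Q_def)
  have disj: "pairwise disjnt Q"
    using assms(3) by (rule pairwise_subset) (auto simp: Q_def)
  have finQ: "finite Q"
    using assms(1) by (simp add: Q_def)
  have card: "card (\<Union>Q) = (\<Sum>p\<in>Q. card p)"
    using assms(2) disj by (intro card_Union_disjoint) (auto simp: Q_def)
  have mem: "of_bool (e \<in> \<Union>Q) = (\<Sum>p\<in>Q. of_bool (e \<in> p) :: real)" for e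
  proof (cases "e \<in> \<Union>Q")
    case True
    then obtain q where q: "q \<in> Q" "e \<in> q" by auto
    have "(e \<in> p) = (p = q)" if "p \<in> Q" for p
      using disj q that by (auto simp: pairwise_def disjnt_def)
    hence "(\<Sum>p\<in>Q. of_bool (e \<in> p) :: real) = (\<Sum>p\<in>Q. of_bool (p = q))"
      by (intro sum.cong) auto
    also have "\<dots> = of_bool (e \<in> \<Union>Q)"
      using q finQ True by (simp add: of_bool_def)
    finally show ?thesis ..
  next
    case False
    thus ?thesis by (auto intro!: sum.neutral[symmetric])
  qed
  have "sum_cost n k a d \<alpha> =
      real (\<Sum>p\<in>Q. card p) + \<alpha> * (\<Sum>j<k. \<Sum>p\<in>Q. of_bool (d j \<in> p))"
    unfolding sum_cost_def U card mem ..
  also have "\<dots> = (\<Sum>p\<in>Q. real (card p) + \<alpha> * (\<Sum>j<k. of_bool (d j \<in> p)))"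
    by (subst sum.swap) (simp add: sum.distrib sum_distrib_left)
  also have "\<dots> = (\<Sum>p\<in>P. (real (card p) + \<alpha> * (\<Sum>j<k. of_bool (d j \<in> p)))
      * of_bool (\<exists>i<n. a i = p))"
    unfolding Q_def using assms(1) by (intro sum.mono_neutral_cong_left) auto
  finally show ?thesis .
qed

lemma expectation_sum_cost:
  assumes "finite P" "\<And>p. p \<in> P \<Longrightarrow> finite p" "pairwise disjnt P" "\<sigma> \<in> strategies n P"
  shows "measure_pmf.expectation (Pi_pmf {..<n} undefined \<sigma>) (\<lambda>a. sum_cost n k a d \<alpha>) =
    (\<Sum>p\<in>P. (real (card p) + \<alpha> * (\<Sum>j<k. of_bool (d j \<in> p))) * hit_prob n \<sigma> p)"
proof -
  let ?M = "Pi_pmf {..<n} undefined \<sigma>"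
  let ?c = "\<lambda>p. real (card p) + \<alpha> * (\<Sum>j<k. of_bool (d j \<in> p))"
  \<comment> \<open>The path formula for the cost holds only for profiles with values in
    \<open>P\<close>, that is, almost surely.\<close>
  have "a ` {..<n} \<subseteq> P" if "a \<in> set_pmf ?M" for a
    using that assms(4) by (auto simp: set_Pi_pmf PiE_dflt_def strategies_def dists_def PiE_def Pi_def)
  hence "measure_pmf.expectation ?M (\<lambda>a. sum_cost n k a d \<alpha>) =
      measure_pmf.expectation ?M (\<lambda>a. \<Sum>p\<in>P. ?c p * indicator {a. \<exists>i<n. a i = p} a)"
    using assms(1-3)
    by (intro integral_cong_AE)
       (auto simp: AE_measure_pmf_iff sum_cost_eq_sum_paths indicator_def of_bool_def)
  also have "\<dots> = (\<Sum>p\<in>P. ?c p * measure_pmf.prob ?M {a. \<exists>i<n. a i = p})"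
    by (subst Bochner_Integration.integral_sum)
       (auto intro!: measure_pmf.integrable_const_bound[where B = 1] integrable_mult_right)
  finally show ?thesis by (simp add: prob_exists_component_eq)
qed

section \<open>Matching bounds for the worst-case cost\<close>

lemma finite_interceptions: "finite E \<Longrightarrow> finite ({..<k::nat} \<rightarrow>\<^sub>E E)"
  by (simp add: finite_PiE)

text \<open>All interceptors attack the single arc \<open>e\<close>.\<close>

lemma worst_cost_ge:
  assumes "finite E" "\<And>p. p \<in> P \<Longrightarrow> p \<subseteq> E" "pairwise disjnt P" "finite P"
    and "\<sigma> \<in> strategies n P" "q \<in> P" "e \<in> q"
  shows "worst_cost E n k \<sigma> \<alpha> \<ge>
    (\<Sum>p\<in>P. real (card p) * hit_prob n \<sigma> p) + \<alpha> * real k * hit_prob n \<sigma> q"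
proof -
  let ?d = "\<lambda>j\<in>{..<k}. e"
  have fin: "finite p" if "p \<in> P" for p
    using assms(1,2) that finite_subset by blast
  have "(e \<in> p) = (p = q)" if "p \<in> P" for p
    using assms(3,6,7) that by (auto simp: pairwise_def disjnt_def)
  hence "(\<Sum>p\<in>P. (real (card p) + \<alpha> * (\<Sum>j<k. of_bool (?d j \<in> p))) * hit_prob n \<sigma> p)
      = (\<Sum>p\<in>P. real (card p) * hit_prob n \<sigma> p
          + (if p = q then \<alpha> * real k * hit_prob n \<sigma> q else 0))"
    by (intro sum.cong) (auto simp: algebra_simps)
  also have "\<dots> = (\<Sum>p\<in>P. real (card p) * hit_prob n \<sigma> p) + \<alpha> * real k * hit_prob n \<sigma> q"
    using assms(4,6) by (simp add: sum.distrib)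
  finally have "(\<Sum>p\<in>P. real (card p) * hit_prob n \<sigma> p) + \<alpha> * real k * hit_prob n \<sigma> q =
      measure_pmf.expectation (Pi_pmf {..<n} undefined \<sigma>) (\<lambda>a. sum_cost n k a ?d \<alpha>)"
    by (subst expectation_sum_cost[OF assms(4) fin assms(3,5)]) auto
  moreover have "?d \<in> {..<k} \<rightarrow>\<^sub>E E"
    using assms(2,6,7) by auto
  ultimately show ?thesis
    unfolding worst_cost_def
    by (simp only:) (intro Max_ge finite_imageI finite_interceptions assms(1) imageI)
qed

text \<open>An arc lies on at most one path, so each interceptor gains at most
  \<open>\<alpha> * M\<close> in expectation; \<open>M \<ge> 0\<close> covers arcs on no path. If
  \<open>M\<close> is the largest hitting probability and is attained on a nonempty path contained
  in \<open>E\<close>, then \<open>worst_cost_ge\<close> gives the reverse bound.\<close>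

lemma worst_cost_le:
  assumes "finite E" "E \<noteq> {}" "\<And>p. p \<in> P \<Longrightarrow> finite p" "pairwise disjnt P" "finite P"
    and "\<sigma> \<in> strategies n P" "\<alpha> \<ge> 0"
    and M: "\<And>p. p \<in> P \<Longrightarrow> hit_prob n \<sigma> p \<le> M" "M \<ge> 0"
  shows "worst_cost E n k \<sigma> \<alpha> \<le>
    (\<Sum>p\<in>P. real (card p) * hit_prob n \<sigma> p) + \<alpha> * real k * M"
proof -
  let ?h = "hit_prob n \<sigma>"
  have hit: "(\<Sum>p\<in>P. of_bool (e \<in> p) * ?h p) \<le> M" for e
  proof (cases "\<exists>q\<in>P. e \<in> q")
    case True
    then obtain q where q: "q \<in> P" "e \<in> q" by auto
    have "(e \<in> p) = (p = q)" if "p \<in> P" for p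
      using assms(4) q that by (auto simp: pairwise_def disjnt_def)
    hence "(\<Sum>p\<in>P. of_bool (e \<in> p) * ?h p) = (\<Sum>p\<in>P. if p = q then ?h q else 0)"
      by (intro sum.cong) auto
    thus ?thesis using q assms(5) M(1) by simp
  next
    case False
    hence "(\<Sum>p\<in>P. of_bool (e \<in> p) * ?h p) = 0"
      by (intro sum.neutral) auto
    thus ?thesis using M(2) by simp
  qed
  have "measure_pmf.expectation (Pi_pmf {..<n} undefined \<sigma>) (\<lambda>a. sum_cost n k a d \<alpha>)
      \<le> (\<Sum>p\<in>P. real (card p) * ?h p) + \<alpha> * real k * M" for d
  proof -
    have "measure_pmf.expectation (Pi_pmf {..<n} undefined \<sigma>) (\<lambda>a. sum_cost n k a d \<alpha>)
        = (\<Sum>p\<in>P. real (card p) * ?h p + \<alpha> * (\<Sum>j<k. of_bool (d j \<in> p) * ?h p))"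
      by (subst expectation_sum_cost[OF assms(5,3,4,6)])
         (auto intro!: sum.cong simp: distrib_right sum_distrib_right)
    also have "\<dots> = (\<Sum>p\<in>P. real (card p) * ?h p)
        + \<alpha> * (\<Sum>p\<in>P. \<Sum>j<k. of_bool (d j \<in> p) * ?h p)"
      by (simp add: sum.distrib flip: sum_distrib_left)
    also have "(\<Sum>p\<in>P. \<Sum>j<k. of_bool (d j \<in> p) * ?h p)
        = (\<Sum>j<k. \<Sum>p\<in>P. of_bool (d j \<in> p) * ?h p)"
      by (rule sum.swap)
    also have "\<dots> \<le> (\<Sum>j<k. M)"
      by (intro sum_mono hit)
    finally show ?thesis
      using assms(7) by (simp add: mult_left_mono mult.assoc)
  qed
  \<comment> \<open>\<open>Max_le_iff\<close> requires a nonempty set of attacks.\<close>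
  moreover have "{..<k} \<rightarrow>\<^sub>E E \<noteq> {}"
    using assms(2) by (simp add: PiE_eq_empty_iff)
  ultimately show ?thesis
    unfolding worst_cost_def using assms(1)
    by (subst Max_le_iff) (auto simp: finite_interceptions)
qed

section \<open>Averaging over the agents and sorting the paths\<close>

lemma prod_le_mean_power:
  fixes x :: "nat \<Rightarrow> real"
  assumes "n \<ge> 1" "\<And>j. j < n \<Longrightarrow> x j \<ge> 0"
  shows "(\<Prod>j<n. x j) \<le> ((\<Sum>j<n. x j) / n) ^ n"
proof -
  let ?P = "\<Prod>j<n. x j"
  have "?P powr (1 / n) \<le> (\<Sum>j<n. x j / n)"
    using arith_geom_mean[of "{..<n}" x] assms by (auto simp: lessThan_empty_iff)
  also have "\<dots> = (\<Sum>j<n. x j) / n"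
    by (simp add: sum_divide_distrib)
  finally have "(?P powr (1 / n)) ^ n \<le> ((\<Sum>j<n. x j) / n) ^ n"
    by (intro power_mono) auto
  moreover have "?P \<ge> 0"
    using assms(2) by (auto intro!: prod_nonneg)
  \<comment> \<open>\<open>powr_realpow\<close> wants a positive base; at \<open>?P = 0\<close> both
    sides vanish because \<open>n \<ge> 1\<close>.\<close>
  hence "(?P powr (1 / n)) ^ n = ?P"
    using assms(1) by (cases "?P = 0")
      (simp_all add: powr_powr flip: powr_realpow del: prod_zero_iff)
  ultimately show ?thesis by simp
qed

text \<open>The AM-GM inequality for the avoidance probabilities: with a fixed mean, their product
  is largest when all agents agree.\<close>

lemma hit_prob_ge_mean:
  assumes "n \<ge> 1"
  shows "hit_prob n \<sigma> p \<ge> 1 - (1 - (\<Sum>j<n. pmf (\<sigma> j) p) / n) ^ n"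
proof -
  have "(\<Sum>j<n. 1 - pmf (\<sigma> j) p) / n = 1 - (\<Sum>j<n. pmf (\<sigma> j) p) / n"
    using assms by (simp add: sum_subtractf field_simps)
  thus ?thesis
    using prod_le_mean_power[of n "\<lambda>j. 1 - pmf (\<sigma> j) p"] assms
    by (simp add: hit_prob_def pmf_le_1)
qed

text \<open>Among the permutations that do not increase \<open>\<Sum>i. l i * b (\<pi> i)\<close>, one minimising
  \<open>\<Sum>i. i * x (\<pi> i)\<close> sorts \<open>x\<close>: transposing an inversion keeps the former condition and
  decreases the latter sum.\<close>

lemma ex_sorting_permutation:
  fixes l b x :: "nat \<Rightarrow> real"
  assumes l: "\<And>i j. i < j \<Longrightarrow> j < m \<Longrightarrow> l i \<le> l j"
    and b: "\<And>i j. i < m \<Longrightarrow> j < m \<Longrightarrow> x i \<le> x j \<Longrightarrow> b i \<le> b j"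
  obtains \<pi> where "\<pi> permutes {..<m}" "\<And>i j. i < j \<Longrightarrow> j < m \<Longrightarrow> x (\<pi> j) \<le> x (\<pi> i)"
    "(\<Sum>i<m. l i * b (\<pi> i)) \<le> (\<Sum>i<m. l i * b i)"
proof -
  define S where "S = {\<pi>. \<pi> permutes {..<m} \<and> (\<Sum>i<m. l i * b (\<pi> i)) \<le> (\<Sum>i<m. l i * b i)}"
  define f where "f \<pi> = (\<Sum>i<m. real i * x (\<pi> i))" for \<pi> :: "nat \<Rightarrow> nat"
  have "finite S"
    unfolding S_def using finite_permutations[of "{..<m}"] by (simp add: finite_subset)
  moreover have "id \<in> S"
    by (simp add: S_def permutes_id)
  ultimately obtain \<pi> where \<pi>: "\<pi> \<in> S" "\<And>\<rho>. \<rho> \<in> S \<Longrightarrow> f \<pi> \<le> f \<rho>"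
    using ex_min_if_finite[of "f ` S"] by (metis empty_iff finite_imageI image_iff image_is_empty not_le)
  have perm: "\<pi> permutes {..<m}"
    using \<pi>(1) by (simp add: S_def)
  have "x (\<pi> j) \<le> x (\<pi> i)" if ij: "i < j" "j < m" for i j
  proof (rule ccontr)
    assume "\<not> ?thesis"
    hence less: "x (\<pi> i) < x (\<pi> j)" by simp
    let ?\<rho> = "\<pi> \<circ> Transposition.transpose i j"
    \<comment> \<open>Only the terms at \<open>i\<close> and \<open>j\<close> change. The identity
      serves twice: with \<open>l\<close> and \<open>b\<close> to stay in \<open>S\<close>, with
      \<open>real\<close> and \<open>x\<close> to lower \<open>f\<close>.\<close>
    have swap: "(\<Sum>r<m. c r * y (?\<rho> r)) =
        (\<Sum>r<m. c r * y (\<pi> r)) - (c j - c i) * (y (\<pi> j) - y (\<pi> i))"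
      for c y :: "nat \<Rightarrow> real"
    proof -
      have *: "sum h {..<m} = h i + h j + sum h ({..<m} - {i, j})" for h :: "nat \<Rightarrow> real"
        using ij by (subst sum.subset_diff[of "{i, j}"]) auto
      have "(\<Sum>r\<in>{..<m} - {i, j}. c r * y (?\<rho> r)) = (\<Sum>r\<in>{..<m} - {i, j}. c r * y (\<pi> r))"
        by (intro sum.cong) (auto simp: Transposition.transpose_def)
      thus ?thesis
        by (simp add: * algebra_simps)
    qed
    have bl: "\<pi> i < m" "\<pi> j < m"
      using permutes_in_image[OF perm] ij by (metis lessThan_iff less_trans)+
    have "?\<rho> permutes {..<m}"
      using perm ij by (intro permutes_compose permutes_swap_id) auto
    moreover have "(l j - l i) * (b (\<pi> j) - b (\<pi> i)) \<ge> 0"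
      using l[OF ij] b[OF bl] less by simp
    ultimately have "?\<rho> \<in> S"
      using \<pi>(1) swap[of l b] by (simp add: S_def)
    moreover have "f ?\<rho> < f \<pi>"
      using swap[of real x] ij less by (simp add: f_def)
    ultimately show False
      using \<pi>(2) by fastforce
  qed
  thus ?thesis
    using that[of \<pi>] \<pi>(1) by (simp add: S_def)
qed

section \<open>The compact set of nonincreasing weights\<close>

text \<open>Sequences instead of vectors of length \<open>m\<close>: all lie in one type with the
  product topology. The zero tail yields nonnegativity and the boundary value \<open>y m = 0\<close>
  of the Abel summation.\<close>

definition dec_weights :: "nat \<Rightarrow> (nat \<Rightarrow> real) set" where
  "dec_weights m = {y. decseq y \<and> (\<forall>i\<ge>m. y i = 0) \<and> (\<Sum>i<m. y i) = 1}"

lemma dec_weights_bounds: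
  assumes "y \<in> dec_weights m"
  shows "0 \<le> y i" "y i \<le> 1"
proof -
  \<comment> \<open>At index \<open>max i m\<close> the sequence is 0, and it cannot have increased
    since \<open>i\<close>.\<close>
  have nonneg: "0 \<le> y i" for i
    using assms decseqD[of y i "max i m"] by (auto simp: dec_weights_def)
  show "0 \<le> y i" by (rule nonneg)
  show "y i \<le> 1"
  proof (cases "i < m")
    case True
    hence "y i \<le> (\<Sum>i<m. y i)"
      using nonneg by (intro member_le_sum) auto
    thus ?thesis using assms by (simp add: dec_weights_def)
  qed (use assms in \<open>auto simp: dec_weights_def\<close>)
qed

text \<open>By Tychonoff the cube \<open>?B\<close> is compact, and \<open>?C\<close> is an
  intersection of closed conditions on finitely many coordinates each.\<close>

lemma compact_dec_weights: "compact (dec_weights m)"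
proof -
  let ?B = "(UNIV :: nat set) \<rightarrow>\<^sub>E {0..1::real}"
  let ?C = "{y :: nat \<Rightarrow> real. \<forall>i. y (Suc i) \<le> y i} \<inter> {y. \<forall>i. m \<le> i \<longrightarrow> y i = 0}
    \<inter> {y. (\<Sum>i<m. y i) = 1}"
  have "compactin (product_topology (\<lambda>_::nat. euclidean :: real topology) UNIV) ?B"
    by (simp add: compactin_PiE)
  hence "compact ?B"
    by (simp add: euclidean_product_topology)
  moreover have "closed ?C"
    by (intro closed_Int closed_Collect_all closed_Collect_le closed_Collect_imp closed_Collect_eq
        continuous_on_sum continuous_on_product_coordinates continuous_on_const) auto
  ultimately have "compact (?B \<inter> ?C)"
    by (rule compact_Int_closed)
  moreover have "dec_weights m = ?B \<inter> ?C"
    using dec_weights_bounds by (auto simp: dec_weights_def decseq_Suc_iff)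
  ultimately show ?thesis by simp
qed

lemma dec_weights_nonempty:
  assumes "m \<ge> 1"
  shows "dec_weights m \<noteq> {}"
proof -
  have "(\<lambda>i. of_bool (i = 0)) \<in> dec_weights m"
    using assms by (auto simp: dec_weights_def decseq_def of_bool_def)
  thus ?thesis by blast
qed

section \<open>Realising weights as strategies in the convex hull\<close>

lemma ex_pmf_of_weights:
  assumes "\<And>i. i < length ps \<Longrightarrow> y i \<ge> 0" "(\<Sum>i<length ps. y i) = 1" "distinct ps"
  obtains \<mu> where "set_pmf \<mu> \<subseteq> set ps" "\<And>i. i < length ps \<Longrightarrow> pmf \<mu> (ps ! i) = y i"
proof -
  let ?m = "length ps"
  let ?f = "\<lambda>i. if i < ?m then y i else 0"
  let ?\<nu> = "embed_pmf ?f"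
  have nn: "0 \<le> ?f i" for i
    using assms(1) by simp
  have "(\<integral>\<^sup>+i. ennreal (?f i) \<partial>count_space UNIV) = (\<Sum>i<?m. ennreal (?f i))"
    by (intro nn_integral_count_space'[of "{..<?m}"]) auto
  also have "\<dots> = ennreal (\<Sum>i<?m. ?f i)"
    using nn by (rule sum_ennreal)
  also have "\<dots> = 1"
    using assms(2) by simp
  finally have pr: "(\<integral>\<^sup>+i. ennreal (?f i) \<partial>count_space UNIV) = 1" .
  have set: "set_pmf ?\<nu> \<subseteq> {..<?m}"
    by (auto simp: set_embed_pmf[OF nn pr])
  let ?\<mu> = "map_pmf ((!) ps) ?\<nu>"
  have "set_pmf ?\<mu> \<subseteq> set ps"
    using set by auto
  moreover have "pmf ?\<mu> (ps ! i) = y i" if "i < ?m" for i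
  proof -
    have inj: "inj_on ((!) ps) {..<?m}"
      using assms(3) by (auto simp: inj_on_def nth_eq_iff_index_eq)
    \<comment> \<open>The fibre of \<open>(!) ps\<close> is controlled only at valid indices; this
      suffices, as \<open>?\<nu>\<close> is supported there.\<close>
    have "(!) ps -` {ps ! i} \<inter> {..<?m} = {i}"
      using inj that by (auto simp: inj_on_def)
    hence "(!) ps -` {ps ! i} \<inter> set_pmf ?\<nu> = {i} \<inter> set_pmf ?\<nu>"
      using set by blast
    hence "measure_pmf.prob ?\<nu> ((!) ps -` {ps ! i}) = measure_pmf.prob ?\<nu> {i}"
      using measure_Int_set_pmf[of ?\<nu> "(!) ps -` {ps ! i}"] measure_Int_set_pmf[of ?\<nu> "{i}"]
      by simp
    hence "pmf ?\<mu> (ps ! i) = measure_pmf.prob ?\<nu> {i}"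
      by (simp only: pmf_map)
    thus ?thesis
      using that by (simp add: measure_pmf_single pmf_embed_pmf[OF nn pr])
  qed
  ultimately show ?thesis by (rule that)
qed

lemma sum_fun_apply: "(\<Sum>a\<in>A. f a) x = (\<Sum>a\<in>A. f a x)"
  by (induction A rule: infinite_finite_induct) auto

text \<open>Abel summation: a nonincreasing \<open>y\<close> is the mixture of the uniform distributions on the
  first \<open>t + 1\<close> paths with weights \<open>(t + 1) (y t - y (t + 1))\<close>.\<close>

lemma dec_weights_in_conv_strategies:
  assumes y: "y \<in> dec_weights (length ps)" and "distinct ps"
    and \<mu>: "set_pmf \<mu> \<subseteq> set ps" "\<And>i. i < length ps \<Longrightarrow> pmf \<mu> (ps ! i) = y i"
  shows "(\<lambda>j\<in>{..<n}. \<mu>) \<in> conv_strategies n ps (uniform_strategies n ps)"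
proof -
  define m where "m = length ps"
  define u where "u t = (\<lambda>j\<in>{..<n}. pmf_of_set (set (take (Suc t) ps)))" for t
  define w where "w t = real (Suc t) * (y t - y (Suc t))" for t
  let ?H = "convex hull (marginals n ps ` uniform_strategies n ps)"
  have ym: "y m = 0" and sum_y: "(\<Sum>i<m. y i) = 1" and dec: "y (Suc t) \<le> y t" for t
    using y by (auto simp: dec_weights_def m_def decseq_Suc_iff)
  \<comment> \<open>Summation by parts; at \<open>r = m\<close> the boundary term vanishes since
    \<open>y m = 0\<close>.\<close>
  have "(\<Sum>t<r. w t) = (\<Sum>i<r. y i) - real r * y r" for r
    by (induction r) (auto simp: w_def algebra_simps)
  hence sum_w: "(\<Sum>t<m. w t) = 1"
    by (simp add: ym sum_y)
  have u_mem: "u t \<in> uniform_strategies n ps" if "t < m" for t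
    using that unfolding uniform_strategies_def u_def m_def by (intro image_eqI[of _ _ "Suc t"]) auto
  have "(\<Sum>t<m. w t *\<^sub>R marginals n ps (u t)) \<in> ?H"
    using sum_w dec u_mem
    by (intro convex_sum convex_convex_hull) (auto simp: w_def intro!: hull_inc)
  also have "(\<Sum>t<m. w t *\<^sub>R marginals n ps (u t)) = marginals n ps (\<lambda>j\<in>{..<n}. \<mu>)"
  proof (intro ext)
    fix j i
    show "(\<Sum>t<m. w t *\<^sub>R marginals n ps (u t)) j i = marginals n ps (\<lambda>j\<in>{..<n}. \<mu>) j i"
    proof (cases "j < n \<and> i < m")
      case True
      \<comment> \<open>The factor \<open>Suc t\<close> in \<open>w t\<close> cancels the uniform
        mass \<open>1 / Suc t\<close>, and the prefix contains \<open>ps ! i\<close> exactly when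
        \<open>i \<le> t\<close>.\<close>
      have "w t * marginals n ps (u t) j i = of_bool (i \<le> t) * (y t - y (Suc t))" if "t < m" for t
      proof -
        have "set (take (Suc t) ps) = (!) ps ` {..t}"
          using that by (simp add: m_def lessThan_Suc_atMost atLeast0LessThan flip: nth_image)
        hence "ps ! i \<in> set (take (Suc t) ps) \<longleftrightarrow> i \<le> t"
          using True that \<open>distinct ps\<close>
          by (auto simp: m_def nth_eq_iff_index_eq)
        moreover have "card (set (take (Suc t) ps)) = Suc t"
          using that \<open>distinct ps\<close> by (simp add: distinct_card m_def)
        moreover have "set (take (Suc t) ps) \<noteq> {}"
          using that by (auto simp: m_def)
        ultimately show ?thesis
          using True by (auto simp: marginals_def u_def w_def m_def pmf_of_set indicator_def)
      qed
      hence "(\<Sum>t<m. w t *\<^sub>R marginals n ps (u t)) j i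
          = (\<Sum>t<m. of_bool (i \<le> t) * (y t - y (Suc t)))"
        by (simp add: sum_fun_apply scaleR_fun_def)
      \<comment> \<open>Telescoping; the case distinction lets the induction on \<open>m\<close>
        start below \<open>i\<close>.\<close>
      also have "\<dots> = (if i \<le> m then y i - y m else 0)"
        by (induction m) (auto simp: le_Suc_eq)
      finally show ?thesis
        using True \<mu>(2) ym by (simp add: marginals_def m_def)
    qed (auto simp: sum_fun_apply scaleR_fun_def marginals_def m_def)
  qed
  finally show ?thesis
    using \<mu>(1) by (auto simp: conv_strategies_def strategies_def dists_def)
qed

section \<open>Optimality of a symmetric strategy with sorted weights\<close>

lemma ex_optimal_conv_strategy:
  fixes E :: "'e set" and ps :: "'e set list"
  assumes E: "finite E" and paths: "\<And>p. p \<in> set ps \<Longrightarrow> p \<subseteq> E \<and> p \<noteq> {}"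
    and disj: "pairwise disjnt (set ps)" and "ps \<noteq> []"
    and dist: "distinct ps" and sorted: "sorted (map card ps)" and "n \<ge> 1" "\<alpha> \<ge> 0"
  obtains \<tau> where "\<tau> \<in> conv_strategies n ps (uniform_strategies n ps)"
    "\<And>\<sigma>. \<sigma> \<in> strategies n (set ps) \<Longrightarrow> worst_cost E n k \<tau> \<alpha> \<le> worst_cost E n k \<sigma> \<alpha>"
proof -
  define m where "m = length ps"
  define l where "l i = real (card (ps ! i))" for i
  \<comment> \<open>\<open>g v\<close> is the probability that a path is used when every agent picks
    it with probability \<open>v\<close>. For nonincreasing weights \<open>y\<close> the largest
    such value is \<open>g (y 0)\<close>, so \<open>\<Psi> y\<close> is the worst cost of the
    symmetric strategy with these weights.\<close>
  define g where "g v = 1 - (1 - v) ^ n" for v :: real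
  define \<Psi> where "\<Psi> y = (\<Sum>i<m. l i * g (y i)) + \<alpha> * real k * g (y 0)" for y
  have m: "m \<ge> 1"
    using \<open>ps \<noteq> []\<close> by (simp add: m_def Suc_le_eq)
  have fin: "finite p" if "p \<in> set ps" for p
    using paths[OF that] E finite_subset by blast
  have E_ne: "E \<noteq> {}"
    using paths \<open>ps \<noteq> []\<close> by (metis bot.extremum_uniqueI last_in_set)
  have g_mono: "g u \<le> g v" if "u \<le> v" "v \<le> 1" for u v
    using that by (auto simp: g_def intro!: power_mono)
  have sum_ps: "(\<Sum>p\<in>set ps. f p) = (\<Sum>i<m. f (ps ! i))" for f :: "'e set \<Rightarrow> real"
    using dist by (simp add: sum_list_sum_nth m_def atLeast0LessThan flip: sum_list_distinct_conv_sum_set)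
  have "continuous_on (dec_weights m) \<Psi>"
    unfolding \<Psi>_def g_def
    by (intro continuous_intros continuous_on_subset[OF continuous_on_product_coordinates]) auto
  then obtain y where y: "y \<in> dec_weights m" "\<And>z. z \<in> dec_weights m \<Longrightarrow> \<Psi> y \<le> \<Psi> z"
    using continuous_attains_inf[OF compact_dec_weights dec_weights_nonempty[OF m]] by blast
  have yb: "0 \<le> y i" "y i \<le> 1" "y i \<le> y 0" for i
    using dec_weights_bounds[OF y(1)] y(1) by (auto simp: dec_weights_def decseq_def)
  obtain \<mu> where \<mu>: "set_pmf \<mu> \<subseteq> set ps" "\<And>i. i < m \<Longrightarrow> pmf \<mu> (ps ! i) = y i"
    using ex_pmf_of_weights[of ps y] y(1) yb(1) dist by (auto simp: m_def dec_weights_def)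
  define \<tau> where "\<tau> = (\<lambda>j\<in>{..<n}. \<mu>)"
  have conv: "\<tau> \<in> conv_strategies n ps (uniform_strategies n ps)"
    unfolding \<tau>_def using y(1) dist \<mu>
    by (intro dec_weights_in_conv_strategies[of y]) (auto simp: m_def)
  hence \<tau>: "\<tau> \<in> strategies n (set ps)"
    by (simp add: conv_strategies_def)
  have hit_\<tau>: "hit_prob n \<tau> (ps ! i) = g (y i)" if "i < m" for i
    using \<mu>(2)[OF that] by (simp add: hit_prob_def \<tau>_def g_def)
  have "hit_prob n \<tau> p \<le> g (y 0)" if "p \<in> set ps" for p
    using that hit_\<tau> yb g_mono by (metis in_set_conv_nth m_def)
  moreover have "0 \<le> g (y 0)"
    using hit_prob_nonneg[of n \<tau> "ps ! 0"] hit_\<tau>[of 0] m by simp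
  ultimately have "worst_cost E n k \<tau> \<alpha> \<le>
      (\<Sum>p\<in>set ps. real (card p) * hit_prob n \<tau> p) + \<alpha> * real k * g (y 0)"
    using E E_ne fin disj \<tau> \<open>\<alpha> \<ge> 0\<close> by (intro worst_cost_le) auto
  also have "\<dots> = \<Psi> y"
    by (simp add: sum_ps \<Psi>_def l_def hit_\<tau>)
  finally have upper: "worst_cost E n k \<tau> \<alpha> \<le> \<Psi> y" .
  have "\<Psi> y \<le> worst_cost E n k \<sigma> \<alpha>" if \<sigma>: "\<sigma> \<in> strategies n (set ps)" for \<sigma>
  proof -
    \<comment> \<open>The marginals of the symmetrised strategy.\<close>
    define x where "x i = (\<Sum>j<n. pmf (\<sigma> j) (ps ! i)) / n" for i
    have x0: "0 \<le> x i" for i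
      by (auto simp: x_def intro!: sum_nonneg divide_nonneg_nonneg)
    have sum1: "(\<Sum>i<m. pmf (\<sigma> j) (ps ! i)) = 1" if "j < n" for j
      using \<sigma> that by (subst sum_ps[symmetric], intro sum_pmf_eq_1)
        (auto simp: strategies_def dists_def)
    have "(\<Sum>i<m. x i) = (\<Sum>j<n. \<Sum>i<m. pmf (\<sigma> j) (ps ! i)) / n"
      unfolding x_def by (subst sum.swap) (simp add: sum_divide_distrib)
    also have "\<dots> = 1"
      using sum1 \<open>n \<ge> 1\<close> by simp
    finally have sum_x: "(\<Sum>i<m. x i) = 1" .
    have x1: "x i \<le> 1" if "i < m" for i
      using that x0 member_le_sum[of i "{..<m}" x] sum_x by auto
    have hit: "g (x i) \<le> hit_prob n \<sigma> (ps ! i)" for i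
      using hit_prob_ge_mean[OF \<open>n \<ge> 1\<close>, of \<sigma> "ps ! i"] by (simp add: g_def x_def)
    have l_mono: "l i \<le> l j" if "i < j" "j < m" for i j
      using sorted_nth_mono[OF sorted, of i j] that by (simp add: l_def m_def)
    obtain \<pi> where \<pi>: "\<pi> permutes {..<m}" "\<And>i j. i < j \<Longrightarrow> j < m \<Longrightarrow> x (\<pi> j) \<le> x (\<pi> i)"
      "(\<Sum>i<m. l i * g (x (\<pi> i))) \<le> (\<Sum>i<m. l i * g (x i))"
      using ex_sorting_permutation[of m l x "\<lambda>i. g (x i)"] l_mono g_mono x1 by blast
    \<comment> \<open>The averages in nonincreasing order, padded with zeros to compete with
      \<open>y\<close> in \<open>dec_weights m\<close>.\<close>
    define z where "z i = (if i < m then x (\<pi> i) else 0)" for i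
    have "z j \<le> z i" if "i \<le> j" for i j
      using that \<pi>(2)[of i j] x0 by (cases "i = j") (auto simp: z_def)
    moreover have "(\<Sum>i<m. z i) = 1"
      using sum.permute[OF \<pi>(1), of x] sum_x by (simp add: z_def)
    ultimately have "z \<in> dec_weights m"
      by (auto simp: dec_weights_def decseq_def z_def)
    hence "\<Psi> y \<le> \<Psi> z"
      by (rule y(2))
    also have "\<dots> = (\<Sum>i<m. l i * g (x (\<pi> i))) + \<alpha> * real k * g (x (\<pi> 0))"
      using m by (simp add: \<Psi>_def z_def)
    also have "\<dots> \<le> (\<Sum>i<m. l i * g (x i)) + \<alpha> * real k * g (x (\<pi> 0))"
      using \<pi>(3) by simp
    \<comment> \<open>The averaging bound is applied to each path, and once more to
      \<open>ps ! \<pi> 0\<close>, the path of largest average, which the interceptors will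
      attack.\<close>
    also have "\<dots> \<le> (\<Sum>i<m. l i * hit_prob n \<sigma> (ps ! i)) + \<alpha> * real k * hit_prob n \<sigma> (ps ! \<pi> 0)"
      using hit \<open>\<alpha> \<ge> 0\<close> by (intro add_mono sum_mono mult_left_mono) (auto simp: l_def)
    also have "\<dots> = (\<Sum>p\<in>set ps. real (card p) * hit_prob n \<sigma> p)
        + \<alpha> * real k * hit_prob n \<sigma> (ps ! \<pi> 0)"
      by (simp add: sum_ps l_def)
    also have "\<dots> \<le> worst_cost E n k \<sigma> \<alpha>"
    proof -
      have "\<pi> 0 < m"
        using permutes_in_image[OF \<pi>(1), of 0] m by simp
      hence q: "ps ! \<pi> 0 \<in> set ps"
        by (simp add: m_def)
      then obtain e where "e \<in> ps ! \<pi> 0"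
        using paths by blast
      thus ?thesis
        using E paths disj \<sigma> q by (intro worst_cost_ge) auto
    qed
    finally show ?thesis .
  qed
  with upper conv that show ?thesis
    by (meson order_trans)
qed

theorem lemma11:
  fixes G :: "('v, 'e) pre_digraph" and s t :: 'v
    and ps :: "'e set list" and n k :: nat and \<alpha> :: real
  assumes "st_graph G s t"
    and "pairwise disjnt (pre_digraph.st_paths G s t)"
    and "distinct ps" and "set ps = pre_digraph.st_paths G s t" and "sorted (map card ps)"
    and "n \<ge> 1" and "k \<ge> 1" and "\<alpha> > 0"
  shows "\<exists>\<sigma> \<tau>.
      is_arg_min (\<lambda>\<sigma>. worst_cost (arcs G) n k \<sigma> \<alpha>)
        (\<lambda>\<sigma>. \<sigma> \<in> strategies n (pre_digraph.st_paths G s t)) \<sigma> \<and>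
      is_arg_min (\<lambda>\<sigma>. worst_cost (arcs G) n k \<sigma> \<alpha>)
        (\<lambda>\<sigma>. \<sigma> \<in> conv_strategies n ps (uniform_strategies n ps)) \<tau> \<and>
      worst_cost (arcs G) n k \<sigma> \<alpha> = worst_cost (arcs G) n k \<tau> \<alpha>"
proof -
  interpret st_graph G s t by fact
  \<comment> \<open>A walk without arcs ends where it starts, so \<open>s \<noteq> t\<close> makes
    every path nonempty.\<close>
  have "p \<subseteq> arcs G \<and> p \<noteq> {}" if "p \<in> set ps" for p
    using that source_neq_sink
    by (auto simp: assms(4) st_paths_def apath_def awalk_def)
  moreover have "ps \<noteq> []"
    using arcs_nonempty arc_on_st_path assms(4) by fastforce
  ultimately obtain \<tau> where "\<tau> \<in> conv_strategies n ps (uniform_strategies n ps)"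
    "\<And>\<sigma>. \<sigma> \<in> strategies n (set ps) \<Longrightarrow>
      worst_cost (arcs G) n k \<tau> \<alpha> \<le> worst_cost (arcs G) n k \<sigma> \<alpha>"
    using ex_optimal_conv_strategy[of "arcs G" ps n \<alpha> k] assms by auto
  thus ?thesis
    \<comment> \<open>One \<open>\<tau>\<close> witnesses both minima: it lies in the hull set,
      whose elements are all strategies, and no strategy costs less.\<close>
    unfolding is_arg_min_def assms(4)[symmetric]
    by (intro exI[of _ \<tau>]) (auto simp: conv_strategies_def not_less)
qed

end
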